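(* Let $0 < \alpha < 1$ and let $\mathscr{C}$ be a spherical $\{\alpha, -\alpha\}$-code in $\mathbb{R}^r$ with Gram matrix $M = M_{\mathscr{C}}$ and $n = |\mathscr{C}|$. If $\lambda$ is an eigenvalue of $M$ with corresponding unit eigenvector $x$, then \[ \lambda \left(\frac{\lambda^2}{\alpha^2 n + 1 - \alpha^2} - \frac{1-\alpha^2}{2\alpha^2} \right) x(u)^2 \geq \lambda - \frac{1-\alpha^2}{2\alpha^2} \] for all $u \in \mathscr{C}$, with equality if $n = \binom{r+1}{2}$.
   Context: A spherical $\{\alpha,-\alpha\}$-code in $\mathbb{R}^r$ is a finite set $\mathscr{C}$ of unit vectors in $\mathbb{R}^r$ with $\langle u, v\rangle \in \{\alpha,-\alpha\}$ for all $u \neq v \in \mathscr{C}$. Its Gram matrix $M_{\mathscr{C}} \in \mathbb{R}^{\mathscr{C}\times\mathscr{C}}$ has entries $M_{\mathscr{C}}(u,v) = \langle u, v\rangle$. Vectors in $\mathbb{R}^{\mathscr{C}}$ (such as the eigenvector $x$) are functions $\mathscr{C}\to\mathbb{R}$, with coordinates $x(u)$.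
   Formalization: The equality claim for n = binom(r+1,2) is stated only for λ ≠ 0; for λ = 0 the left side is 0 and the right side is negative, so equality fails (e.g. three unit vectors at 120° in R²). The inequality is stated for all eigenvalues. *)

theory Defs
  imports "HOL-Analysis.Analysis"
begin

definition spherical_code :: "real set \<Rightarrow> 'a::real_inner set \<Rightarrow> bool" where
  "spherical_code L C \<longleftrightarrow>
     finite C \<and> (\<forall>u\<in>C. norm u = 1) \<and> (\<forall>u\<in>C. \<forall>v\<in>C. u \<noteq> v \<longrightarrow> u \<bullet> v \<in> L)"

text \<open>Vectors and matrices over a finite index set \<open>I\<close> are functions on \<open>I\<close> and on \<open>I \<times> I\<close>;
  values outside the index set are irrelevant.  The Euclidean norm of such a vector \<open>x\<close> is
  \<open>L2_set x I\<close>.\<close>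

definition gram_matrix :: "'a::real_inner set \<Rightarrow> 'a \<Rightarrow> 'a \<Rightarrow> real" where
  "gram_matrix C = (\<lambda>u\<in>C. \<lambda>v\<in>C. u \<bullet> v)"

definition eigenvector_on :: "'i set \<Rightarrow> ('i \<Rightarrow> 'i \<Rightarrow> real) \<Rightarrow> ('i \<Rightarrow> real) \<Rightarrow> real \<Rightarrow> bool" where
  "eigenvector_on I A x \<mu> \<longleftrightarrow>
     (\<exists>u\<in>I. x u \<noteq> 0) \<and> (\<forall>u\<in>I. (\<Sum>v\<in>I. A u v * x v) = \<mu> * x u)"

end

theory Submission
  imports Defs
begin

text \<open>
  The projections \<open>v v\<^sup>T\<close> with \<open>v \<in> C\<close> are unit vectors with pairwise inner products \<open>\<alpha>\<^sup>2\<close> in the space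
  of symmetric \<open>r \<times> r\<close> matrices with the Frobenius inner product, so their Gram matrix
  \<open>(1 - \<alpha>\<^sup>2) I + \<alpha>\<^sup>2 J\<close> has an explicit inverse. Put \<open>w = \<Sum>v. x(v) v\<close>. The inequality states that the
  symmetrization of \<open>u w\<^sup>T\<close> is at least as long as its orthogonal projection onto the span of these
  projections. If \<open>n = r (r + 1) / 2\<close>, they are a basis of the symmetric matrices, and equality holds.
\<close>

text \<open>The system matrix is (1 - \<beta>) I + \<beta> J. Summing its equations over
  \<open>I\<close> gives \<open>sum c I = sum b I / D\<close>, where \<open>D > 0\<close> is the
  common row sum; each single equation then yields \<open>c v\<close>.\<close>

lemma equiangular_solve:
  fixes b :: "'i \<Rightarrow> real"
  assumes "finite I" "w \<in> I" "0 \<le> \<beta>" "\<beta> < 1"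
  defines "c \<equiv> \<lambda>v. (b v - \<beta> * sum b I / (\<beta> * real (card I) + 1 - \<beta>)) / (1 - \<beta>)"
  shows "(\<Sum>v\<in>I. c v * (if v = w then 1 else \<beta>)) = b w"
proof -
  define D where "D = \<beta> * real (card I) + 1 - \<beta>"
  have D: "D > 0" unfolding D_def using assms
    by (smt (verit) mult_nonneg_nonneg of_nat_0_le_iff)
  have sc: "sum c I = (sum b I - real (card I) * (\<beta> * sum b I / D)) / (1 - \<beta>)"
    by (simp add: c_def D_def sum_divide_distrib [symmetric] sum_subtractf)
  have sc': "sum c I = sum b I / D"
    unfolding sc using D \<open>\<beta> < 1\<close> by (simp add: field_simps) (simp add: D_def algebra_simps)
  have "(\<Sum>v\<in>I. c v * (if v = w then 1 else \<beta>)) = (\<Sum>v\<in>I. \<beta> * c v + (if v = w then (1 - \<beta>) * c w else 0))"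
    by (intro sum.cong) (auto simp: algebra_simps)
  also have "\<dots> = \<beta> * sum c I + (1 - \<beta>) * c w"
    using assms by (simp add: sum.distrib sum_distrib_left)
  also have "\<dots> = b w"
    unfolding sc' using \<open>\<beta> < 1\<close> by (simp add: c_def D_def)
  finally show ?thesis .
qed

text \<open>Pairing a vanishing combination with each \<open>f u\<close> and summing over
  \<open>u\<close> gives \<open>D * sum ?a I = 0\<close> with \<open>D > 0\<close>. Once the total
  is zero, the equation for each \<open>u\<close> makes its coefficient zero.\<close>

lemma equiangular_independent:
  fixes f :: "'i \<Rightarrow> 'b::euclidean_space"
  assumes "finite I" "0 \<le> \<beta>" "\<beta> < 1"
    and ip: "\<And>u v. u \<in> I \<Longrightarrow> v \<in> I \<Longrightarrow> f u \<bullet> f v = (if u = v then 1 else \<beta>)"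
  shows "inj_on f I" and "independent (f ` I)"
proof -
  show inj: "inj_on f I"
    by (rule inj_onI) (use ip \<open>\<beta> < 1\<close> in \<open>metis less_irrefl\<close>)
  show "independent (f ` I)"
    unfolding independent_explicit
  proof (intro conjI allI impI ballI)
    show "finite (f ` I)" using \<open>finite I\<close> by simp
  next
    fix a y assume 0: "(\<Sum>v\<in>f ` I. a v *\<^sub>R v) = 0" and "y \<in> f ` I"
    then obtain w where w: "w \<in> I" "y = f w" by auto
    define D where "D = \<beta> * real (card I) + 1 - \<beta>"
    have D: "D > 0" unfolding D_def using assms
      by (smt (verit) mult_nonneg_nonneg of_nat_0_le_iff)
    let ?a = "\<lambda>v. a (f v)"
    have 1: "\<beta> * sum ?a I + (1 - \<beta>) * ?a u = 0" if "u \<in> I" for u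
    proof -
      have "0 = (\<Sum>v\<in>f ` I. a v *\<^sub>R v) \<bullet> f u" using 0 by simp
      also have "\<dots> = (\<Sum>v\<in>I. ?a v * (f v \<bullet> f u))"
        by (simp add: sum.reindex [OF inj] inner_sum_left)
      also have "\<dots> = (\<Sum>v\<in>I. \<beta> * ?a v + (if v = u then (1 - \<beta>) * ?a u else 0))"
        using that by (intro sum.cong) (auto simp: ip algebra_simps)
      also have "\<dots> = \<beta> * sum ?a I + (1 - \<beta>) * ?a u"
        using that \<open>finite I\<close> by (simp add: sum.distrib sum_distrib_left)
      finally show ?thesis by simp
    qed
    have "0 = (\<Sum>u\<in>I. \<beta> * sum ?a I + (1 - \<beta>) * ?a u)" using 1 by simp
    also have "\<dots> = D * sum ?a I"
      by (simp add: sum.distrib sum_distrib_left [symmetric] D_def) (simp add: algebra_simps)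
    finally have "sum ?a I = 0" using D by simp
    with 1 [OF w(1)] show "a y = 0" using \<open>\<beta> < 1\<close> w by simp
  qed
qed

text \<open>Bessel's inequality for an equiangular family: \<open>q\<close> is b^T G^(-1) b, where G
  is the Gram matrix of \<open>f\<close> and b lists the values \<open>X \<bullet> f v\<close>. This
  is the squared length of the projection of \<open>X\<close> onto the span.\<close>

lemma equiangular_projection:
  fixes f :: "'i \<Rightarrow> 'b::real_inner" and X :: 'b
  assumes "finite I" "0 \<le> \<beta>" "\<beta> < 1"
    and ip: "\<And>u v. u \<in> I \<Longrightarrow> v \<in> I \<Longrightarrow> f u \<bullet> f v = (if u = v then 1 else \<beta>)"
  defines "q \<equiv> ((\<Sum>v\<in>I. (X \<bullet> f v)\<^sup>2)
      - \<beta> * (\<Sum>v\<in>I. X \<bullet> f v)\<^sup>2 / (\<beta> * real (card I) + 1 - \<beta>)) / (1 - \<beta>)"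
  shows "q \<le> X \<bullet> X" and "X \<in> span (f ` I) \<Longrightarrow> q = X \<bullet> X"
proof -
  define b where "b = (\<lambda>v. X \<bullet> f v)"
  define D where "D = \<beta> * real (card I) + 1 - \<beta>"
  define c where "c = (\<lambda>v. (b v - \<beta> * sum b I / D) / (1 - \<beta>))"
  \<comment> \<open>The coefficients \<open>c\<close> solve G c = b, so \<open>Y\<close> is the
    orthogonal projection of \<open>X\<close>.\<close>
  define Y where "Y = (\<Sum>v\<in>I. c v *\<^sub>R f v)"
  have orth: "(X - Y) \<bullet> f w = 0" if "w \<in> I" for w
  proof -
    have "Y \<bullet> f w = (\<Sum>v\<in>I. c v * (if v = w then 1 else \<beta>))"
      unfolding Y_def using that by (auto simp: inner_sum_left ip intro!: sum.cong)
    also have "\<dots> = b w"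
      unfolding c_def D_def by (rule equiangular_solve) (use assms that in auto)
    finally show ?thesis by (simp add: inner_diff_left b_def)
  qed
  have orth_span: "(X - Y) \<bullet> z = 0" if "z \<in> span (f ` I)" for z
    using that by (rule orthogonal_to_span [unfolded orthogonal_def]) (auto simp: orth)
  have Y: "Y \<in> span (f ` I)"
    unfolding Y_def by (intro span_sum span_scale span_base) auto
  have "X \<bullet> Y = (\<Sum>v\<in>I. (b v * b v - \<beta> * sum b I / D * b v) / (1 - \<beta>))"
    unfolding Y_def inner_sum_right by (intro sum.cong) (auto simp: c_def b_def algebra_simps diff_divide_distrib)
  also have "\<dots> = q"
    unfolding q_def b_def D_def
    by (simp add: sum_divide_distrib [symmetric] sum_subtractf sum_distrib_left [symmetric] power2_eq_square)
  finally have q: "X \<bullet> Y = q" .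
  \<comment> \<open>Pythagoras, as \<open>X - Y\<close> is orthogonal to \<open>Y\<close>. If
    \<open>X\<close> is in the span, so is \<open>X - Y\<close>, which is then orthogonal to
    itself.\<close>
  have eq: "X \<bullet> X - q = (X - Y) \<bullet> (X - Y)"
    using orth_span [OF Y] q by (simp add: inner_diff_left inner_diff_right inner_commute)
  show "q \<le> X \<bullet> X"
    using eq inner_ge_zero [of "X - Y"] by linarith
  show "q = X \<bullet> X" if "X \<in> span (f ` I)"
    using eq orth_span [OF span_diff [OF that Y]] by linarith
qed

definition outer :: "real ^ 'm \<Rightarrow> real ^ 'n \<Rightarrow> real ^ 'n ^ 'm" where
  "outer u v = (\<chi> i j. u $ i * v $ j)"

text \<open>The inner product of nested vectors is the Frobenius one. On \<open>outer u u\<close>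
  and \<open>outer v v\<close> it gives the square of \<open>u \<bullet> v\<close>, which erases the
  sign of an entry \<alpha> or -\<alpha>.\<close>

lemma inner_outer: "outer u v \<bullet> outer a b = (u \<bullet> a) * (v \<bullet> b)"
  unfolding outer_def inner_vec_def sum_product by (simp add: mult_ac)

text \<open>The symmetric 0/1 matrices \<open>E {i, j}\<close>, with i = j allowed, span; Pascal's
  rule counts their index sets.\<close>

lemma dim_symmetric_matrices_le:
  "dim {X :: real ^ 'r ^ 'r. transpose X = X} \<le> (CARD('r) + 1) choose 2"
proof -
  define E :: "'r set \<Rightarrow> real ^ 'r ^ 'r" where "E = (\<lambda>A. \<chi> i j. if A = {i, j} then 1 else 0)"
  define K :: "'r set set" where "K = {A. A \<subseteq> UNIV \<and> card A = 1} \<union> {A. A \<subseteq> UNIV \<and> card A = 2}"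
  have sub: "{X :: real ^ 'r ^ 'r. transpose X = X} \<subseteq> span (E ` K)"
  proof
    fix X :: "real ^ 'r ^ 'r" assume "X \<in> {X. transpose X = X}"
    then have sym: "X $ j $ i = X $ i $ j" for i j
      by (metis (mono_tags) mem_Collect_eq transpose_def vec_lambda_beta)
    have pairs: "{i, j} \<in> K" for i j :: 'r
      by (cases "i = j") (auto simp: K_def)
    \<comment> \<open>By symmetry an entry depends only on the set of its two indices, so whichever
      ordering \<open>SOME\<close> picks reads off the same value.\<close>
    define c where "c = (\<lambda>A. let p = SOME p. {fst p, snd p} = A in X $ fst p $ snd p)"
    have c: "c {i, j} = X $ i $ j" for i j
    proof -
      define p :: "'r \<times> 'r" where "p = (SOME p. {fst p, snd p} = {i, j})"
      have "{fst p, snd p} = {i, j}"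
        unfolding p_def by (rule someI [of _ "(i, j)"]) simp
      then have "X $ fst p $ snd p = X $ i $ j"
        using sym by (auto simp: doubleton_eq_iff)
      then show ?thesis
        by (simp only: c_def Let_def p_def)
    qed
    have "(\<Sum>A\<in>K. c A *\<^sub>R E A) $ i $ j = X $ i $ j" for i j
    proof -
      have "(\<Sum>A\<in>K. c A *\<^sub>R E A) $ i $ j = (\<Sum>A\<in>K. if A = {i, j} then c {i, j} else 0)"
        unfolding sum_component by (intro sum.cong) (auto simp: E_def)
      also have "\<dots> = X $ i $ j"
        using pairs [of i j] c by simp
      finally show ?thesis .
    qed
    then have "X = (\<Sum>A\<in>K. c A *\<^sub>R E A)"
      by (simp add: vec_eq_iff)
    then show "X \<in> span (E ` K)"
      by (metis (no_types, lifting) imageI span_base span_scale span_sum)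
  qed
  have "card K = (CARD('r) choose 1) + (CARD('r) choose 2)"
    unfolding K_def
    by (subst card_Un_disjoint) (simp_all only: n_subsets finite, auto)
  also have "\<dots> = (CARD('r) + 1) choose 2"
    by (simp add: numeral_2_eq_2)
  finally have K: "card K = (CARD('r) + 1) choose 2" .
  have "dim {X :: real ^ 'r ^ 'r. transpose X = X} \<le> card (E ` K)"
    by (rule dim_le_card [OF sub]) simp
  also have "\<dots> \<le> card K" by (rule card_image_le) simp
  finally show ?thesis using K by simp
qed

theorem theorem2p1:
  fixes \<alpha> lam :: real and C :: "(real ^ 'r) set" and x :: "real ^ 'r \<Rightarrow> real" and n :: nat
  assumes "0 < \<alpha>" and "\<alpha> < 1"
    and "spherical_code {\<alpha>, - \<alpha>} C"
    and "n = card C"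
    and "eigenvector_on C (gram_matrix C) x lam"
    and "L2_set x C = 1"
  shows "(\<forall>u\<in>C. lam * (lam\<^sup>2 / (\<alpha>\<^sup>2 * real n + 1 - \<alpha>\<^sup>2) - (1 - \<alpha>\<^sup>2) / (2 * \<alpha>\<^sup>2)) * (x u)\<^sup>2
                  \<ge> lam - (1 - \<alpha>\<^sup>2) / (2 * \<alpha>\<^sup>2)) \<and>
         (n = (CARD('r) + 1) choose 2 \<and> lam \<noteq> 0 \<longrightarrow>
           (\<forall>u\<in>C. lam * (lam\<^sup>2 / (\<alpha>\<^sup>2 * real n + 1 - \<alpha>\<^sup>2) - (1 - \<alpha>\<^sup>2) / (2 * \<alpha>\<^sup>2)) * (x u)\<^sup>2
                  = lam - (1 - \<alpha>\<^sup>2) / (2 * \<alpha>\<^sup>2)))"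
proof -
  define D where "D = \<alpha>\<^sup>2 * real n + 1 - \<alpha>\<^sup>2"
  define f :: "real ^ 'r \<Rightarrow> real ^ 'r ^ 'r" where "f = (\<lambda>v. outer v v)"
  define w where "w = (\<Sum>v\<in>C. x v *\<^sub>R v)"
  \<comment> \<open>Symmetrizing keeps the inner products with the symmetric matrices
    \<open>f v\<close>, and it puts \<open>X u\<close> into the space that these span in the
    equality case.\<close>
  define X where "X = (\<lambda>u. (1 / 2) *\<^sub>R (outer u w + outer w u))"
  have fin: "finite C" and unit: "\<And>u. u \<in> C \<Longrightarrow> u \<bullet> u = 1"
    and angle: "\<And>u v. u \<in> C \<Longrightarrow> v \<in> C \<Longrightarrow> u \<noteq> v \<Longrightarrow> (u \<bullet> v)\<^sup>2 = \<alpha>\<^sup>2"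
    using assms(3) by (force simp: spherical_code_def norm_eq_1)+
  have x1: "(\<Sum>v\<in>C. (x v)\<^sup>2) = 1"
    using assms(6) by (simp add: L2_set_def)
  \<comment> \<open>The eigenvector equation at \<open>u\<close>; it makes
    \<open>w \<bullet> w\<close> the quadratic form x^T M x = \<open>lam\<close>, so
    \<open>lam\<close> is nonnegative.\<close>
  have uw: "u \<bullet> w = lam * x u" if "u \<in> C" for u
    using assms(5) that
    by (simp add: eigenvector_on_def gram_matrix_def w_def inner_sum_right mult.commute)
  have ww: "w \<bullet> w = lam"
  proof -
    have "w \<bullet> w = (\<Sum>v\<in>C. x v * (v \<bullet> w))"
      by (subst (1) w_def) (simp add: inner_sum_left)
    also have "\<dots> = (\<Sum>v\<in>C. lam * (x v)\<^sup>2)"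
      by (intro sum.cong) (auto simp: uw power2_eq_square)
    finally show ?thesis using x1 by (simp add: sum_distrib_left [symmetric])
  qed
  have lam0: "lam \<ge> 0" using ww inner_ge_zero [of w] by simp
  have a2: "0 < \<alpha>\<^sup>2" "\<alpha>\<^sup>2 < 1"
    using assms(1,2) by (auto simp: power_less_one_iff)
  have ip: "f u \<bullet> f v = (if u = v then 1 else \<alpha>\<^sup>2)" if "u \<in> C" "v \<in> C" for u v
    using that unit angle by (auto simp: f_def inner_outer power2_eq_square)
  have D: "D > 0"
    using a2 unfolding D_def by (smt (verit) mult_nonneg_nonneg of_nat_0_le_iff)
  have XX: "X u \<bullet> X u = (lam + lam\<^sup>2 * (x u)\<^sup>2) / 2" if "u \<in> C" for u
    using that unit [OF that] uw [OF that]
    by (simp add: X_def inner_add_left inner_add_right inner_outer ww inner_commute [of w u] power2_eq_square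
      field_simps)
  have Xf: "X u \<bullet> f v = lam * ((u \<bullet> v) * x v)" if "u \<in> C" "v \<in> C" for u v
    using uw [OF that(2)]
    by (simp add: X_def f_def inner_add_left inner_outer inner_commute [of w v])
  have s1: "(\<Sum>v\<in>C. X u \<bullet> f v) = lam\<^sup>2 * x u" if "u \<in> C" for u
  proof -
    have "(\<Sum>v\<in>C. X u \<bullet> f v) = lam * (u \<bullet> w)"
      using that by (simp add: Xf w_def inner_sum_right sum_distrib_left mult.commute)
    then show ?thesis using uw [OF that] by (simp add: power2_eq_square)
  qed
  have s2: "(\<Sum>v\<in>C. (X u \<bullet> f v)\<^sup>2) = lam\<^sup>2 * (\<alpha>\<^sup>2 + (1 - \<alpha>\<^sup>2) * (x u)\<^sup>2)" if "u \<in> C" for u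
  proof -
    have "(\<Sum>v\<in>C. (X u \<bullet> f v)\<^sup>2)
        = (\<Sum>v\<in>C. lam\<^sup>2 * (\<alpha>\<^sup>2 * (x v)\<^sup>2 + (if v = u then (1 - \<alpha>\<^sup>2) * (x u)\<^sup>2 else 0)))"
      using that angle unit by (intro sum.cong) (auto simp: Xf power_mult_distrib algebra_simps)
    then show ?thesis
      using that fin x1 by (simp add: sum_distrib_left [symmetric] sum.distrib)
  qed
  define q where "q = (\<lambda>u. (lam\<^sup>2 * (\<alpha>\<^sup>2 + (1 - \<alpha>\<^sup>2) * (x u)\<^sup>2) - \<alpha>\<^sup>2 * (lam\<^sup>2 * x u)\<^sup>2 / D) / (1 - \<alpha>\<^sup>2))"
  have ineq: "q u \<le> X u \<bullet> X u" if "u \<in> C" for u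
    using equiangular_projection(1) [of C "\<alpha>\<^sup>2" f "X u"] fin a2 ip that
    by (simp add: q_def s1 s2 D_def assms(4))
  have eq: "q u = X u \<bullet> X u" if "u \<in> C" "X u \<in> span (f ` C)" for u
    using equiangular_projection(2) [of C "\<alpha>\<^sup>2" f "X u"] fin a2 ip that
    by (simp add: q_def s1 s2 D_def assms(4))
  \<comment> \<open>The gap in the claim, scaled by 2 \<alpha>^2 \<open>lam\<close>, is a positive
    multiple of the squared distance from \<open>X u\<close> to the span. The sign of the gap
    follows by cancelling \<open>lam > 0\<close>.\<close>
  have diff: "2 * \<alpha>\<^sup>2 * lam * (lam * (lam\<^sup>2 / D - (1 - \<alpha>\<^sup>2) / (2 * \<alpha>\<^sup>2)) * (x u)\<^sup>2 - (lam - (1 - \<alpha>\<^sup>2) / (2 * \<alpha>\<^sup>2)))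
      = 2 * (1 - \<alpha>\<^sup>2) * (X u \<bullet> X u - q u)" if "u \<in> C" for u
    unfolding XX [OF that] q_def using a2 D
    by (simp add: divide_simps) (simp add: algebra_simps power2_eq_square power4_eq_xxxx)
  show ?thesis
    unfolding D_def [symmetric]
  proof (intro conjI ballI impI)
    fix u assume u: "u \<in> C"
    show "lam - (1 - \<alpha>\<^sup>2) / (2 * \<alpha>\<^sup>2) \<le> lam * (lam\<^sup>2 / D - (1 - \<alpha>\<^sup>2) / (2 * \<alpha>\<^sup>2)) * (x u)\<^sup>2"
    proof (cases "lam = 0")
      case True
      then show ?thesis using a2 by simp
    next
      case False
      have "0 \<le> 2 * (1 - \<alpha>\<^sup>2) * (X u \<bullet> X u - q u)"
        using ineq [OF u] a2 by simp
      moreover have "0 < 2 * \<alpha>\<^sup>2 * lam" using False lam0 a2 by simp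
      ultimately show ?thesis
        unfolding diff [OF u, symmetric] by (simp only: zero_le_mult_iff) linarith
    qed
  next
    fix u assume n: "n = (CARD('r) + 1) choose 2 \<and> lam \<noteq> 0" and u: "u \<in> C"
    let ?S = "{X :: real ^ 'r ^ 'r. transpose X = X}"
    have indep: "inj_on f C" "independent (f ` C)"
      using equiangular_independent [of C "\<alpha>\<^sup>2" f] fin a2 ip by auto
    \<comment> \<open>An independent subset of a space with at least as many elements as its
      dimension spans it.\<close>
    have "?S \<subseteq> span (f ` C)"
    proof (rule card_ge_dim_independent)
      show "f ` C \<subseteq> ?S"
        by (auto simp: f_def outer_def transpose_def vec_eq_iff mult.commute)
      show "dim ?S \<le> card (f ` C)"
        using dim_symmetric_matrices_le n assms(4) by (simp add: card_image [OF indep(1)])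
    qed (rule indep(2))
    moreover have "X u \<in> ?S"
      by (auto simp: X_def outer_def transpose_def vec_eq_iff algebra_simps)
    ultimately have "q u = X u \<bullet> X u" using eq [OF u] by blast
    \<comment> \<open>Cancelling \<open>lam\<close> requires \<open>lam \<noteq> 0\<close>: at
      \<open>lam = 0\<close> the left side is 0 and the right side is negative.\<close>
    then show "lam * (lam\<^sup>2 / D - (1 - \<alpha>\<^sup>2) / (2 * \<alpha>\<^sup>2)) * (x u)\<^sup>2 = lam - (1 - \<alpha>\<^sup>2) / (2 * \<alpha>\<^sup>2)"
      using diff [OF u] n a2 by simp
  qed
qed

end
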